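(* Let $N, K \ge 1$ and let $\boldsymbol{\Gamma}(z) = [\Gamma_{ij}(z)]_{i,j=1}^{K,K}$ be a matrix polynomial, not identically zero, with entries $\Gamma_{ij} \in \mathbb{C}_{\le 2(N-1)}[z]$, that admits a factorization $\Gamma_{ij}(z) = X_i(z)\widetilde{X}_j(z)$ for all $i,j\in\{1,\ldots,K\}$, with $X_1,\ldots,X_K \in \mathbb{C}_{\le N-1}[z]$. Then this factorization is unique up to global scaling if and only if the greatest common divisor $H(z) = \gcd\{\Gamma_{ij}\}_{i,j=1}^{K,K}$ is $1$ or its roots lie only on the complex unit circle $\mathbb{T}$.
   Context: $\mathbb{T} = \{z\in\mathbb{C} : |z|=1\}$. $\mathbb{C}_{\le D}[z]$ is the $(D+1)$-dimensional space of complex univariate polynomials of degree at most $D$; a polynomial is always considered together with the space (degree bound) it belongs to. For $A(z)=\sum_{n=0}^{D} a[n]z^n \in \mathbb{C}_{\le D}[z]$, the conjugate reversal is $\widetilde{A}(z) = z^{D}\,\overline{A(\overline{z}^{-1})} = \sum_{n=0}^{D}\overline{a[D-n]}z^n \in \mathbb{C}_{\le D}[z]$. Multiplication is the map $\mathbb{C}_{\le D_1}[z]\times\mathbb{C}_{\le D_2}[z]\to\mathbb{C}_{\le D_1+D_2}[z]$. Roots: $A\in\mathbb{C}_{\le D}[z]\setminus\{0\}$ has a root at $\infty$ of multiplicity $\mu$ if exactly its $\mu$ leading coefficients $a[D],\ldots,a[D-\mu+1]$ vanish; roots are counted in $\mathbb{C}\cup\{\infty\}$, so that a nonzero $A\in\mathbb{C}_{\le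 D}[z]$ has exactly $D$ roots with multiplicity. Divisibility: $C\in\mathbb{C}_{\le M}[z]$ has a divisor $B\in\mathbb{C}_{\le D}[z]\setminus\{0\}$ if there is $A\in\mathbb{C}_{\le M-D}[z]$ with $C=AB$. The $\gcd$ of a set of polynomials (each in its own space) is the polynomial $H\in\mathbb{C}_{\le D}[z]$ with highest possible $D$ that divides all of them in this sense; $\gcd\{A,0\}=A$, and the gcd of zero polynomials is $0\in\mathbb{C}_{\le 0}[z]$. The gcd is defined up to multiplication by a nonzero scalar, and equalities involving gcd are meant modulo such a scalar. Uniqueness up to global scaling: for any $Y_1,\ldots,Y_K\in\mathbb{C}_{\le N-1}[z]$ with $\Gamma_{ij}=Y_i\widetilde{Y}_j$ for all $i,j$, there is $c\in\mathbb{T}$ with $Y_i = cX_i$ for all $i$. *)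

theory Defs
  imports "HOL-Computational_Algebra.Computational_Algebra"
begin

text \<open>A polynomial is always considered together with a degree bound \<open>D\<close>, i.e. as an element of
  the space \<open>polys_le D\<close>. The bound is passed as an explicit argument to every notion that depends
  on it (reversal, root at infinity, divisibility, gcd).\<close>

definition polys_le :: "nat \<Rightarrow> complex poly set" where
  "polys_le D = {A. degree A \<le> D}"

definition conj_rev :: "nat \<Rightarrow> complex poly \<Rightarrow> complex poly" where
  "conj_rev D A = (\<Sum>n\<le>D. monom (cnj (coeff A (D - n))) n)"

text \<open>The number of vanishing leading coefficients \<open>a[D], a[D-1], \<dots>\<close>; meaningful only for nonzero
  \<open>A \<in> polys_le D\<close>, in which case it equals \<open>D - degree A\<close>.\<close>

definition mult_infinity :: "nat \<Rightarrow> complex poly \<Rightarrow> nat" where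
  "mult_infinity D A = (LEAST m. coeff A (D - m) \<noteq> 0)"

text \<open>Points of the extended complex plane are encoded in \<^typ>\<open>complex option\<close>, with \<^term>\<open>None\<close>
  standing for the point at infinity.\<close>

definition root_mult :: "nat \<Rightarrow> complex poly \<Rightarrow> complex option \<Rightarrow> nat" where
  "root_mult D A w = (case w of Some z \<Rightarrow> order z A | None \<Rightarrow> mult_infinity D A)"

definition ext_roots :: "nat \<Rightarrow> complex poly \<Rightarrow> complex option set" where
  "ext_roots D A = {w. root_mult D A w > 0}"

definition unit_circle :: "complex set" where
  "unit_circle = {z. cmod z = 1}"

text \<open>\<open>B\<close> in \<open>polys_le D\<close> divides \<open>C\<close> in \<open>polys_le M\<close>. The condition \<open>D \<le> M\<close> is needed because
  subtraction on natural numbers truncates.\<close>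

definition divides_le :: "nat \<Rightarrow> complex poly \<Rightarrow> nat \<Rightarrow> complex poly \<Rightarrow> bool" where
  "divides_le D B M C \<longleftrightarrow>
     B \<in> polys_le D \<and> B \<noteq> 0 \<and> D \<le> M \<and> (\<exists>A \<in> polys_le (M - D). C = A * B)"

text \<open>Zero polynomials are disregarded as long as some member of the family is nonzero: this is the
  convention \<open>gcd {A, 0} = A\<close>, which has to hold whatever the degree bound of \<open>0\<close> is.\<close>

definition common_divisor_le :: "nat \<Rightarrow> complex poly \<Rightarrow> (nat \<times> complex poly) set \<Rightarrow> bool" where
  "common_divisor_le D B S \<longleftrightarrow> (\<forall>(M, C) \<in> S. C \<noteq> 0 \<longrightarrow> divides_le D B M C)"

text \<open>\<open>H\<close> in \<open>polys_le D\<close> is a greatest common divisor of the family \<open>S\<close> of pairs (degree bound,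
  polynomial). This is a predicate rather than a function since a gcd is determined only up to a
  nonzero scalar.\<close>

definition is_gcd_le :: "nat \<Rightarrow> complex poly \<Rightarrow> (nat \<times> complex poly) set \<Rightarrow> bool" where
  "is_gcd_le D H S \<longleftrightarrow>
     (if \<forall>(M, C) \<in> S. C = 0 then D = 0 \<and> H = 0
      else common_divisor_le D H S \<and> (\<forall>D' B. common_divisor_le D' B S \<longrightarrow> D' \<le> D))"

lemma ex_is_gcd_le:
  assumes "\<And>M C. (M, C) \<in> S \<Longrightarrow> C \<in> polys_le M"
  shows "\<exists>D H. is_gcd_le D H S"
proof (cases "\<forall>(M, C) \<in> S. C = 0")
  case True
  then show ?thesis by (auto simp: is_gcd_le_def)
next
  case False
  then obtain M C where MC: "(M, C) \<in> S" "C \<noteq> 0" by auto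
  let ?P = "\<lambda>D. \<exists>B. common_divisor_le D B S"
  have "common_divisor_le 0 1 S"
    using assms by (auto simp: common_divisor_le_def divides_le_def polys_le_def)
  then have P0: "?P 0" by blast
  have bd: "D \<le> M" if "?P D" for D
    using that MC by (auto simp: common_divisor_le_def divides_le_def)
  have "?P (Greatest ?P)"
    by (rule GreatestI_nat[where P = ?P, OF P0]) (use bd in blast)
  then obtain H where H: "common_divisor_le (Greatest ?P) H S" by blast
  have "D' \<le> Greatest ?P" if "common_divisor_le D' B S" for D' B
    by (rule Greatest_le_nat[where P = ?P and b = M]) (use that bd in blast)+
  with H False show ?thesis unfolding is_gcd_le_def by (metis (lifting))
qed

definition eq_mod_scalar :: "nat \<Rightarrow> complex poly \<Rightarrow> nat \<Rightarrow> complex poly \<Rightarrow> bool" where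
  "eq_mod_scalar D A D' B \<longleftrightarrow> D = D' \<and> (\<exists>c. c \<noteq> 0 \<and> A = smult c B)"

definition factorization ::
  "nat \<Rightarrow> nat \<Rightarrow> (nat \<Rightarrow> nat \<Rightarrow> complex poly) \<Rightarrow> (nat \<Rightarrow> complex poly) \<Rightarrow> bool" where
  "factorization N K \<Gamma> X \<longleftrightarrow>
     (\<forall>i\<in>{1..K}. X i \<in> polys_le (N - 1)) \<and>
     (\<forall>i\<in>{1..K}. \<forall>j\<in>{1..K}. \<Gamma> i j = X i * conj_rev (N - 1) (X j))"

definition unique_up_to_scaling ::
  "nat \<Rightarrow> nat \<Rightarrow> (nat \<Rightarrow> nat \<Rightarrow> complex poly) \<Rightarrow> (nat \<Rightarrow> complex poly) \<Rightarrow> bool" where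
  "unique_up_to_scaling N K \<Gamma> X \<longleftrightarrow>
     (\<forall>Y. factorization N K \<Gamma> Y \<longrightarrow> (\<exists>c\<in>unit_circle. \<forall>i\<in>{1..K}. Y i = smult c (X i)))"

end

theory Submission
  imports Defs "HOL-Computational_Algebra.Field_as_Ring"
begin

text \<open>
  Write \<open>A\<^sup>*\<close> for the conjugate reversal of \<open>A\<close> in the space that \<open>A\<close> belongs to. Reversal is a
  multiplicative involution, and it moves the roots on the extended plane by the reflection
  \<open>w \<mapsto> 1 / cnj w\<close> in the unit circle. The points of the circle are the only ones that this
  reflection fixes, which is why the circle decides uniqueness.

  The gcd enters only through its roots, which are exactly the points at which all \<open>\<Gamma> i j\<close> vanish
  (\<open>vanishes_at_gcd_iff\<close>). Since \<open>\<Gamma> i j = X i * (X j)\<^sup>*\<close>, such a point or its reflection is a common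
  root of all \<open>X i\<close> (\<open>common_root_of_products\<close>); conversely, a common root of all \<open>X i\<close> is a root
  of every \<open>\<Gamma> i j\<close>.

  Uniqueness fails if the gcd has a root off the circle. Then all \<open>X i\<close> share a root \<open>v\<close> off the
  circle, so \<open>X i = B * W i\<close> with \<open>B\<close> in \<open>polys_le 1\<close> vanishing at \<open>v\<close> only. Reflecting just this
  root, \<open>Y i = B\<^sup>* * W i\<close>, leaves every product \<open>X i * (X j)\<^sup>* = B * B\<^sup>* * W i * (W j)\<^sup>*\<close> unchanged,
  but \<open>Y\<close> is not a multiple of \<open>X\<close> because \<open>B\<^sup>*\<close> does not vanish at \<open>v\<close>
  (\<open>common_root_on_circle_if_unique\<close>).

  Uniqueness holds if all roots of the gcd are on the circle. For a second factorization \<open>Y\<close>, all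
  the quotients \<open>Y i / X i\<close> are one rational function; in lowest terms \<open>A / B\<close> this gives
  \<open>X i = B * W i\<close> and \<open>Y i = A * W i\<close>, and comparing \<open>\<Gamma>\<close> yields \<open>A * A\<^sup>* = B * B\<^sup>*\<close>, where \<open>A\<close> and
  \<open>B\<close> are taken in \<open>polys_le d\<close> for the larger degree \<open>d\<close> of the two
  (\<open>two_factorizations_coprime_ratio\<close>). If \<open>d > 0\<close>, then \<open>B\<close> has a root in the extended plane;
  it is common to all \<open>X i\<close>, hence lies on the circle, where \<open>A\<^sup>*\<close> vanishes iff \<open>A\<close> does. So
  \<open>A\<close> shares it with \<open>B\<close>, contradicting coprimality. Hence \<open>A\<close> and \<open>B\<close> are constants of
  equal modulus.
\<close>

section \<open>Roots in the extended plane\<close>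

text \<open>Unlike \<open>ext_roots\<close>, this also treats the zero polynomial sensibly: it vanishes everywhere. So
  the zero entries of \<open>\<Gamma>\<close> need no special treatment in statements about common roots.\<close>

definition vanishes_at :: "nat \<Rightarrow> complex poly \<Rightarrow> complex option \<Rightarrow> bool" where
  "vanishes_at D A w = (case w of Some z \<Rightarrow> poly A z = 0 | None \<Rightarrow> coeff A D = 0)"

lemma vanishes_at_simps [simp]:
  "vanishes_at D A (Some z) \<longleftrightarrow> poly A z = 0"
  "vanishes_at D A None \<longleftrightarrow> coeff A D = 0"
  by (simp_all add: vanishes_at_def)

lemma vanishes_at_0 [simp]: "vanishes_at D 0 w"
  by (cases w) auto

lemma polys_le_mult: "A \<in> polys_le a \<Longrightarrow> B \<in> polys_le b \<Longrightarrow> A * B \<in> polys_le (a + b)"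
  unfolding polys_le_def using degree_mult_le[of A B] by auto

lemma ext_roots_iff_vanishes_at:
  assumes "A \<noteq> 0" "A \<in> polys_le D"
  shows "w \<in> ext_roots D A \<longleftrightarrow> vanishes_at D A w"
proof (cases w)
  case None
  define m where "m = mult_infinity D A"
  have "coeff A (D - (D - degree A)) \<noteq> 0"
    using assms by (simp add: polys_le_def)
  then have m: "coeff A (D - m) \<noteq> 0"
    unfolding m_def mult_infinity_def by (rule LeastI)
  have "m = 0 \<longleftrightarrow> coeff A D \<noteq> 0"
  proof
    assume "m = 0"
    then show "coeff A D \<noteq> 0" using m by simp
  next
    assume "coeff A D \<noteq> 0"
    then show "m = 0"
      unfolding m_def mult_infinity_def by (intro Least_eq_0) simp
  qed
  then show ?thesis
    using None by (auto simp: ext_roots_def root_mult_def m_def)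
next
  case (Some z)
  then show ?thesis
    using assms by (simp add: ext_roots_def root_mult_def order_root)
qed

lemma vanishes_at_mult:
  assumes "A \<in> polys_le a" "B \<in> polys_le b"
  shows "vanishes_at (a + b) (A * B) w \<longleftrightarrow> vanishes_at a A w \<or> vanishes_at b B w"
proof (cases w)
  case None
  have "coeff (A * B) (a + b) = coeff A a * coeff B b"
  proof (cases "degree A = a \<and> degree B = b")
    case True
    then show ?thesis by (metis coeff_mult_degree_sum)
  next
    case False
    then have "degree A < a \<or> degree B < b"
      using assms by (auto simp: polys_le_def)
    moreover from this have "degree (A * B) < a + b"
      using assms degree_mult_le[of A B] by (auto simp: polys_le_def)
    ultimately show ?thesis by (auto simp: coeff_eq_0)
  qed
  then show ?thesis using None by simp
qed auto

lemma vanishes_at_bound_0_iff: "A \<in> polys_le 0 \<Longrightarrow> vanishes_at 0 A w \<longleftrightarrow> A = 0"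
  by (cases w) (auto simp: polys_le_def elim!: degree_eq_zeroE)

text \<open>Counting the point at infinity, the fundamental theorem of algebra has no exception for
  constants: a nonzero constant in \<open>polys_le D\<close>, \<open>D > 0\<close>, vanishes at infinity.\<close>

lemma exists_extended_root:
  assumes "B \<in> polys_le D" "D > 0"
  shows "\<exists>w. vanishes_at D B w"
proof (cases "degree B = D")
  case True
  then have "\<not> constant (poly B)"
    using assms(2) by (simp add: constant_degree)
  then have "\<exists>z. poly B z = 0"
    by (rule fundamental_theorem_of_algebra)
  then show ?thesis by (metis vanishes_at_simps(1))
next
  case False
  then have "coeff B D = 0"
    using assms by (auto simp: polys_le_def coeff_eq_0)
  then show ?thesis by (metis vanishes_at_simps(2))
qed

text \<open>The generator, in \<open>polys_le 1\<close>, of the polynomials vanishing at a given point. For infinity it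
  is the constant \<open>1\<close>, whose only root as a polynomial of degree at most \<open>1\<close> is infinity.\<close>

definition root_factor :: "complex option \<Rightarrow> complex poly" where
  "root_factor w = (case w of Some z \<Rightarrow> [:- z, 1:] | None \<Rightarrow> 1)"

lemma root_factor_in_polys_le: "root_factor w \<in> polys_le 1"
  by (cases w) (auto simp: root_factor_def polys_le_def)

lemma root_factor_nonzero [simp]: "root_factor w \<noteq> 0"
  by (cases w) (auto simp: root_factor_def)

lemma vanishes_at_root_factor: "vanishes_at 1 (root_factor w) v \<longleftrightarrow> v = w"
  by (cases w; cases v) (auto simp: root_factor_def)

lemma extended_factor_theorem:
  assumes "A \<in> polys_le D" "vanishes_at D A w" "D > 0"
  shows "\<exists>W \<in> polys_le (D - 1). A = root_factor w * W"
proof (cases w)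
  case None
  then have "degree A \<noteq> D"
    using assms(2,3) by (metis degree_0 leading_coeff_0_iff nat_less_le vanishes_at_simps(2))
  then have "A \<in> polys_le (D - 1)"
    using assms(1) by (auto simp: polys_le_def)
  then show ?thesis
    using None by (auto simp: root_factor_def)
next
  case (Some z)
  then obtain W where W: "A = [:- z, 1:] * W"
    using assms(2) by (auto simp: poly_eq_0_iff_dvd elim: dvdE)
  have "W \<in> polys_le (D - 1)"
  proof (cases "W = 0")
    case False
    then have "degree A = 1 + degree W"
      unfolding W by (subst degree_mult_eq) auto
    then show ?thesis using assms(1) by (simp add: polys_le_def)
  qed (simp add: polys_le_def)
  then show ?thesis using W Some by (auto simp: root_factor_def)
qed

section \<open>Conjugate reversal and reflection in the unit circle\<close>

lemma coeff_conj_rev: "coeff (conj_rev D A) n = (if n \<le> D then cnj (coeff A (D - n)) else 0)"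
  by (simp add: conj_rev_def coeff_sum)

lemma conj_rev_in_polys_le [simp]: "conj_rev D A \<in> polys_le D"
  by (auto simp: polys_le_def coeff_conj_rev intro!: degree_le)

lemma conj_rev_conj_rev: "A \<in> polys_le D \<Longrightarrow> conj_rev D (conj_rev D A) = A"
  by (auto simp: poly_eq_iff coeff_conj_rev polys_le_def coeff_eq_0)

lemma conj_rev_eq_0_iff: "A \<in> polys_le D \<Longrightarrow> conj_rev D A = 0 \<longleftrightarrow> A = 0"
  by (metis conj_rev_conj_rev coeff_0 coeff_conj_rev complex_cnj_zero poly_eqI)

lemma poly_conj_rev:
  assumes "A \<in> polys_le D" "z \<noteq> 0"
  shows "poly (conj_rev D A) z = z ^ D * cnj (poly A (1 / cnj z))"
proof -
  have "poly A (1 / cnj z) = (\<Sum>n\<le>D. coeff A n * (1 / cnj z) ^ n)"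
    using assms(1) by (subst poly_as_sum_of_monoms'[of A D, symmetric])
      (simp_all add: polys_le_def poly_sum poly_monom)
  then have "z ^ D * cnj (poly A (1 / cnj z)) = (\<Sum>n\<le>D. cnj (coeff A n) * (z ^ D * (1 / z) ^ n))"
    by (simp add: sum_distrib_left mult_ac)
  also have "\<dots> = (\<Sum>n\<le>D. cnj (coeff A n) * z ^ (D - n))"
    using assms(2) by (intro sum.cong) (auto simp: power_diff power_divide)
  also have "\<dots> = (\<Sum>n\<le>D. cnj (coeff A (D - n)) * z ^ n)"
    by (rule sum.reindex_bij_witness[where i = "\<lambda>n. D - n" and j = "\<lambda>n. D - n"]) auto
  also have "\<dots> = poly (conj_rev D A) z"
    by (simp add: conj_rev_def poly_sum poly_monom)
  finally show ?thesis by simp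
qed

lemma conj_rev_mult:
  assumes "A \<in> polys_le a" "B \<in> polys_le b"
  shows "conj_rev (a + b) (A * B) = conj_rev a A * conj_rev b B"
proof -
  \<comment> \<open>The evaluation formula is only available away from \<open>0\<close>; the extra factor \<open>z\<close> covers \<open>0\<close>.\<close>
  have "poly ([:0, 1:] * conj_rev (a + b) (A * B)) z
      = poly ([:0, 1:] * (conj_rev a A * conj_rev b B)) z" for z
    using assms by (cases "z = 0") (simp_all add: poly_conj_rev polys_le_mult power_add)
  then have "[:0, 1:] * conj_rev (a + b) (A * B) = [:0, 1:] * (conj_rev a A * conj_rev b B)"
    by (simp only: poly_eq_poly_eq_iff[symmetric] fun_eq_iff) simp
  then show ?thesis by (metis mult_cancel_left pCons_eq_0_iff zero_neq_one)
qed

definition circle_reflection :: "complex option \<Rightarrow> complex option" where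
  "circle_reflection w =
     (case w of None \<Rightarrow> Some 0 | Some z \<Rightarrow> if z = 0 then None else Some (1 / cnj z))"

lemma circle_reflection_fixed_iff:
  "circle_reflection w = w \<longleftrightarrow> w \<in> Some ` unit_circle"
proof (cases w)
  case (Some z)
  have "z * cnj z = 1 \<longleftrightarrow> cmod z = 1"
    by (metis complex_norm_square norm_ge_zero of_real_eq_1_iff power2_eq_1_iff
        one_neq_neg_one order_antisym_conv zero_le_one abs_norm_cancel abs_neg_one)
  then show ?thesis
    using Some by (auto simp: circle_reflection_def unit_circle_def field_simps)
qed (auto simp: circle_reflection_def)

lemma circle_reflection_involution [simp]: "circle_reflection (circle_reflection w) = w"
  by (cases w) (auto simp: circle_reflection_def)

lemma vanishes_at_conj_rev:
  assumes "A \<in> polys_le D"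
  shows "vanishes_at D (conj_rev D A) w \<longleftrightarrow> vanishes_at D A (circle_reflection w)"
proof (cases w)
  case None
  then show ?thesis
    by (simp add: circle_reflection_def coeff_conj_rev poly_0_coeff_0)
next
  case (Some z)
  show ?thesis
  proof (cases "z = 0")
    case True
    then show ?thesis
      using Some by (simp add: circle_reflection_def coeff_conj_rev poly_0_coeff_0)
  next
    case False
    then show ?thesis
      using Some assms by (simp add: circle_reflection_def poly_conj_rev)
  qed
qed

section \<open>Roots of the greatest common divisor\<close>

text \<open>A common root \<open>w\<close> that \<open>H\<close> misses would have to be a root of every cofactor of \<open>H\<close>, so that
  \<open>root_factor w * H\<close>, of larger degree bound, would still be a common divisor.\<close>

lemma vanishes_at_gcd_iff:
  assumes gcd: "is_gcd_le D H S" and nz: "\<exists>(M, C) \<in> S. C \<noteq> 0"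
  shows "vanishes_at D H w \<longleftrightarrow> (\<forall>(M, C) \<in> S. vanishes_at M C w)"
proof -
  have cd: "common_divisor_le D H S"
    and greatest: "\<And>D' B. common_divisor_le D' B S \<Longrightarrow> D' \<le> D"
    using gcd nz by (auto simp: is_gcd_le_def split: if_splits)
  have H: "H \<in> polys_le D" "H \<noteq> 0"
    using cd nz by (auto simp: common_divisor_le_def divides_le_def)
  have cofactor: "\<exists>A \<in> polys_le (M - D). C = A * H \<and> D \<le> M"
    if "(M, C) \<in> S" "C \<noteq> 0" for M C
    using cd that by (auto simp: common_divisor_le_def divides_le_def)
  have root_iff: "vanishes_at M (A * H) w \<longleftrightarrow> vanishes_at (M - D) A w \<or> vanishes_at D H w"
    if "A \<in> polys_le (M - D)" "D \<le> M" for M A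
    using vanishes_at_mult[OF that(1) H(1), of w] that(2) by simp
  show ?thesis
  proof
    assume w: "vanishes_at D H w"
    have "vanishes_at M C w" if "(M, C) \<in> S" for M C
    proof (cases "C = 0")
      case False
      then show ?thesis
        using cofactor[OF that] root_iff w by blast
    qed simp
    then show "\<forall>(M, C) \<in> S. vanishes_at M C w" by blast
  next
    assume common: "\<forall>(M, C) \<in> S. vanishes_at M C w"
    show "vanishes_at D H w"
    proof (rule ccontr)
      assume not_root: "\<not> vanishes_at D H w"
      have "divides_le (Suc D) (root_factor w * H) M C" if C: "(M, C) \<in> S" "C \<noteq> 0" for M C
      proof -
        obtain A where A: "A \<in> polys_le (M - D)" "C = A * H" "D \<le> M"
          using cofactor[OF C] by blast
        have root: "vanishes_at (M - D) A w"
          using common C(1) root_iff[OF A(1,3)] A(2) not_root by auto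
        have pos: "M - D > 0"
          using A(1,2) C(2) root vanishes_at_bound_0_iff[of A w] by (metis gr0I mult_zero_left)
        obtain W where "W \<in> polys_le (M - D - 1)" "A = root_factor w * W"
          using extended_factor_theorem[OF A(1) root pos] by blast
        then show ?thesis
          using A pos H polys_le_mult[OF root_factor_in_polys_le H(1)]
          by (auto simp: divides_le_def mult_ac intro!: bexI[of _ W])
      qed
      then have "common_divisor_le (Suc D) (root_factor w * H) S"
        by (auto simp: common_divisor_le_def)
      then show False using greatest by fastforce
    qed
  qed
qed

section \<open>Comparing factorizations\<close>

text \<open>If some \<open>X i\<close> does not vanish at \<open>w\<close>, the products force every reversal to vanish there.\<close>

lemma common_root_of_products:
  assumes "\<forall>i\<in>I. X i \<in> polys_le M"
    and "\<forall>i\<in>I. \<forall>j\<in>I. vanishes_at (M + M) (X i * conj_rev M (X j)) w"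
  shows "(\<forall>i\<in>I. vanishes_at M (X i) w) \<or> (\<forall>i\<in>I. vanishes_at M (X i) (circle_reflection w))"
proof (rule disjCI)
  assume "\<not> (\<forall>j\<in>I. vanishes_at M (X j) (circle_reflection w))"
  then obtain j where j: "j \<in> I" "\<not> vanishes_at M (conj_rev M (X j)) w"
    using assms(1) vanishes_at_conj_rev by blast
  show "\<forall>i\<in>I. vanishes_at M (X i) w"
    using assms j vanishes_at_mult[OF _ conj_rev_in_polys_le] by blast
qed

text \<open>Replacing \<open>v\<close> by its reflection in all \<open>X i\<close> at once does not change the products. By
  uniqueness this can only rescale the \<open>X i\<close>, so the reflection fixes \<open>v\<close>.\<close>

lemma common_root_on_circle_if_unique:
  assumes unique: "unique_up_to_scaling N K \<Gamma> X" and fac: "factorization N K \<Gamma> X"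
    and nz: "k \<in> {1..K}" "X k \<noteq> 0"
    and common: "\<forall>i\<in>{1..K}. vanishes_at (N - 1) (X i) v"
  shows "v \<in> Some ` unit_circle"
proof -
  define M where "M = N - 1"
  define B where "B = root_factor v"
  have X: "X i \<in> polys_le M" if "i \<in> {1..K}" for i
    using fac that by (auto simp: factorization_def M_def)
  have B: "B \<in> polys_le 1" unfolding B_def by (rule root_factor_in_polys_le)
  have "M > 0"
    using X[OF nz(1)] common nz vanishes_at_bound_0_iff[of "X k" v]
    unfolding M_def[symmetric] by (metis gr0I)
  have "\<exists>W \<in> polys_le (M - 1). X i = B * W" if "i \<in> {1..K}" for i
    using extended_factor_theorem[OF X[OF that] _ \<open>M > 0\<close>] common that by (auto simp: M_def B_def)
  then obtain W where W: "\<And>i. i \<in> {1..K} \<Longrightarrow> W i \<in> polys_le (M - 1)"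
      "\<And>i. i \<in> {1..K} \<Longrightarrow> X i = B * W i"
    by metis
  define Y where "Y = (\<lambda>i. conj_rev 1 B * W i)"
  have M1: "1 + (M - 1) = M" using \<open>M > 0\<close> by simp
  have rev: "conj_rev M (A * W i) = conj_rev 1 A * conj_rev (M - 1) (W i)"
    if "i \<in> {1..K}" "A \<in> polys_le 1" for i A
    using conj_rev_mult[OF that(2) W(1)[OF that(1)]] M1 by simp
  have "Y i * conj_rev M (Y j) = X i * conj_rev M (X j)" if "i \<in> {1..K}" "j \<in> {1..K}" for i j
  proof -
    have "conj_rev M (Y j) = B * conj_rev (M - 1) (W j)"
      using rev[OF that(2) conj_rev_in_polys_le] by (simp only: Y_def conj_rev_conj_rev[OF B])
    moreover have "conj_rev M (X j) = conj_rev 1 B * conj_rev (M - 1) (W j)"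
      using rev[OF that(2) B] W(2)[OF that(2)] by simp
    ultimately show ?thesis
      by (simp only: Y_def W(2)[OF that(1)] mult_ac)
  qed
  moreover have "Y i \<in> polys_le M" if "i \<in> {1..K}" for i
    using polys_le_mult[OF conj_rev_in_polys_le W(1)[OF that], of 1 B] M1 by (simp add: Y_def)
  ultimately have "factorization N K \<Gamma> Y"
    using fac by (auto simp: factorization_def M_def)
  then obtain c where c: "c \<in> unit_circle" "\<forall>i\<in>{1..K}. Y i = smult c (X i)"
    using unique by (auto simp: unique_up_to_scaling_def)
  have "W k * conj_rev 1 B = W k * smult c B"
    using c(2) nz(1) W(2)[OF nz(1)] by (auto simp: Y_def mult_ac)
  moreover have "W k \<noteq> 0" using nz W(2) by auto
  ultimately have "conj_rev 1 B = smult c B" by (metis mult_left_cancel)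
  moreover have "vanishes_at 1 (smult c B) v"
    using vanishes_at_root_factor[of v v] by (cases v) (auto simp: B_def)
  ultimately have "vanishes_at 1 B (circle_reflection v)"
    using vanishes_at_conj_rev[OF B] by simp
  then show ?thesis
    unfolding B_def vanishes_at_root_factor by (simp add: circle_reflection_fixed_iff)
qed

text \<open>\<open>A / B\<close> is \<open>Y k / X k\<close> in lowest terms. Cancelling the reversals of \<open>X k\<close> and \<open>Y k\<close> gives
  \<open>X i * Y k = Y i * X k\<close>, so the same fraction serves every \<open>i\<close>. The bound \<open>d\<close> is common to \<open>A\<close>
  and \<open>B\<close>, so that a drop in degree of one of them is visible as a root at infinity.\<close>

lemma two_factorizations_coprime_ratio:
  assumes X: "factorization N K \<Gamma> X" and Y: "factorization N K \<Gamma> Y"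
    and nz: "k \<in> {1..K}" "X k \<noteq> 0"
  obtains A B W d where "coprime A B" "A \<noteq> 0" "B \<noteq> 0" "d = max (degree A) (degree B)" "d \<le> N - 1"
    "\<And>i. i \<in> {1..K} \<Longrightarrow> W i \<in> polys_le (N - 1 - d)"
    "\<And>i. i \<in> {1..K} \<Longrightarrow> X i = B * W i" "\<And>i. i \<in> {1..K} \<Longrightarrow> Y i = A * W i"
    "A * conj_rev d A = B * conj_rev d B"
proof -
  define M where "M = N - 1"
  have Xle: "X i \<in> polys_le M" and Yle: "Y i \<in> polys_le M" if "i \<in> {1..K}" for i
    using X Y that by (auto simp: factorization_def M_def)
  have eq: "X i * conj_rev M (X j) = Y i * conj_rev M (Y j)" if "i \<in> {1..K}" "j \<in> {1..K}" for i j
    using X Y that unfolding factorization_def M_def by metis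
  have "conj_rev M (X k) \<noteq> 0" using Xle nz by (simp add: conj_rev_eq_0_iff)
  then have "Y k \<noteq> 0" and revY: "conj_rev M (Y k) \<noteq> 0"
    using eq[OF nz(1) nz(1)] nz(2) by auto
  obtain A B where AB: "Y k = A * gcd (Y k) (X k)" "X k = B * gcd (Y k) (X k)" "coprime A B"
    using gcd_coprime_exists[of "Y k" "X k"] nz(2) by (metis gcd_eq_0_iff)
  have A0: "A \<noteq> 0" and B0: "B \<noteq> 0" using AB \<open>Y k \<noteq> 0\<close> nz(2) by auto
  have ratio: "X i * A = Y i * B" if i: "i \<in> {1..K}" for i
  proof -
    have "(X i * Y k) * (conj_rev M (X k) * conj_rev M (Y k))
        = (Y i * X k) * (conj_rev M (X k) * conj_rev M (Y k))"
      using eq[OF i nz(1)] eq[OF nz(1) nz(1)] by algebra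
    then have "X i * Y k = Y i * X k"
      using revY \<open>conj_rev M (X k) \<noteq> 0\<close> by simp
    then have "(X i * A) * gcd (Y k) (X k) = (Y i * B) * gcd (Y k) (X k)"
      using AB(1,2) by (metis mult.assoc)
    then show ?thesis using nz(2) by simp
  qed
  have "\<exists>W. X i = B * W \<and> Y i = A * W" if i: "i \<in> {1..K}" for i
  proof -
    have "B dvd X i * A" using ratio[OF i] by simp
    then have "B dvd X i"
      using AB(3) by (simp add: coprime_commute coprime_dvd_mult_left_iff)
    then obtain W where W: "X i = B * W" by (elim dvdE)
    then have "Y i * B = (A * W) * B" using ratio[OF i] unfolding W by algebra
    then have "Y i = A * W" using B0 by (metis mult_cancel_right)
    then show ?thesis using W by blast
  qed
  then obtain W where W: "\<And>i. i \<in> {1..K} \<Longrightarrow> X i = B * W i" "\<And>i. i \<in> {1..K} \<Longrightarrow> Y i = A * W i"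
    by metis
  define d where "d = max (degree A) (degree B)"
  have deg: "d + degree (W i) \<le> M" if "i \<in> {1..K}" "W i \<noteq> 0" for i
    using Xle[OF that(1)] Yle[OF that(1)] that(2) A0 B0
    unfolding W(1)[OF that(1)] W(2)[OF that(1)] polys_le_def d_def by (simp add: degree_mult_eq)
  have Wk: "W k \<noteq> 0" using W(1)[OF nz(1)] nz(2) by auto
  then have dM: "d \<le> M" using deg nz(1) by fastforce
  have Wle: "W i \<in> polys_le (M - d)" if "i \<in> {1..K}" for i
    using deg[OF that] by (cases "W i = 0") (auto simp: polys_le_def)
  have A: "A \<in> polys_le d" and B: "B \<in> polys_le d" by (auto simp: polys_le_def d_def)
  have "conj_rev M (C * W k) = conj_rev d C * conj_rev (M - d) (W k)" if "C \<in> polys_le d" for C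
    using conj_rev_mult[OF that Wle[OF nz(1)]] dM by simp
  then have "(B * conj_rev d B) * (W k * conj_rev (M - d) (W k))
      = (A * conj_rev d A) * (W k * conj_rev (M - d) (W k))"
    using eq[OF nz(1) nz(1)] A B W nz(1) by (simp add: mult_ac)
  moreover have "W k * conj_rev (M - d) (W k) \<noteq> 0"
    using Wk Wle[OF nz(1)] by (simp add: conj_rev_eq_0_iff)
  ultimately have "A * conj_rev d A = B * conj_rev d B" by (metis mult_cancel_right)
  then show ?thesis
    using that[OF AB(3) A0 B0 d_def dM[unfolded M_def], of W] Wle W unfolding M_def by blast
qed

text \<open>A second factorization differs from \<open>X\<close> by a coprime pair \<open>A\<close>, \<open>B\<close>. A root of \<open>B\<close> is common to
  all \<open>X i\<close>, so it is on the circle, and there \<open>A * conj_rev d A = B * conj_rev d B\<close> makes it a root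
  of \<open>A\<close> as well. So there is none, not even at infinity, and \<open>d = 0\<close>.\<close>

lemma unique_if_common_roots_on_circle:
  assumes X: "factorization N K \<Gamma> X" and nz: "k \<in> {1..K}" "X k \<noteq> 0"
    and circle: "\<And>w. \<forall>i\<in>{1..K}. vanishes_at (N - 1) (X i) w \<Longrightarrow> w \<in> Some ` unit_circle"
  shows "unique_up_to_scaling N K \<Gamma> X"
  unfolding unique_up_to_scaling_def
proof (intro allI impI)
  fix Y assume Y: "factorization N K \<Gamma> Y"
  obtain A B W d where AB: "coprime A B" "A \<noteq> 0" "B \<noteq> 0"
      and d: "d = max (degree A) (degree B)" "d \<le> N - 1"
      and Wle: "\<And>i. i \<in> {1..K} \<Longrightarrow> W i \<in> polys_le (N - 1 - d)"
      and XW: "\<And>i. i \<in> {1..K} \<Longrightarrow> X i = B * W i" and YW: "\<And>i. i \<in> {1..K} \<Longrightarrow> Y i = A * W i"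
      and norm: "A * conj_rev d A = B * conj_rev d B"
    using two_factorizations_coprime_ratio[OF X Y nz] by metis
  have A: "A \<in> polys_le d" and B: "B \<in> polys_le d" using d by (auto simp: polys_le_def)
  have "d = 0"
  proof (rule ccontr)
    assume "d \<noteq> 0"
    then obtain w where w: "vanishes_at d B w" using exists_extended_root[OF B] by auto
    have "vanishes_at (N - 1) (X i) w" if "i \<in> {1..K}" for i
      using vanishes_at_mult[OF B Wle[OF that], of w] w d(2) XW[OF that]
      by (simp only: le_add_diff_inverse simp_thms)
    then have on_circle: "w \<in> Some ` unit_circle" by (intro circle) blast
    then obtain z where z: "w = Some z" by blast
    have "vanishes_at (d + d) (A * conj_rev d A) w"
      unfolding norm using w vanishes_at_mult[OF B conj_rev_in_polys_le] by blast
    then have "vanishes_at d A w \<or> vanishes_at d A (circle_reflection w)"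
      using vanishes_at_mult[OF A conj_rev_in_polys_le] vanishes_at_conj_rev[OF A] by blast
    then have "vanishes_at d A w"
      using on_circle by (simp add: circle_reflection_fixed_iff[symmetric])
    then have "[:- z, 1:] dvd A" "[:- z, 1:] dvd B"
      using w z by (simp_all add: poly_eq_0_iff_dvd)
    then have "is_unit [:- z, 1:]" using AB(1) by (meson coprime_common_divisor)
    then show False by (simp add: is_unit_pCons_iff)
  qed
  then have "degree A = 0" "degree B = 0" using d(1) by auto
  then obtain a b where ab: "A = [:a:]" "B = [:b:]" by (auto elim!: degree_eq_zeroE)
  have nonzero: "a \<noteq> 0" "b \<noteq> 0" using AB ab by auto
  have "a * cnj a = b * cnj b"
    using norm ab \<open>d = 0\<close> by (simp add: conj_rev_def monom_0 mult.commute)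
  then have "(cmod a)\<^sup>2 = (cmod b)\<^sup>2"
    by (metis complex_norm_square of_real_eq_iff)
  then have "cmod a = cmod b" by simp
  then have "a / b \<in> unit_circle"
    using nonzero by (simp add: unit_circle_def norm_divide)
  moreover have "\<forall>i\<in>{1..K}. Y i = smult (a / b) (X i)"
    using XW YW ab nonzero by simp
  ultimately show "\<exists>c\<in>unit_circle. \<forall>i\<in>{1..K}. Y i = smult c (X i)" by blast
qed

theorem theorem1:
  fixes N K :: nat
    and \<Gamma> :: "nat \<Rightarrow> nat \<Rightarrow> complex poly"
    and X :: "nat \<Rightarrow> complex poly"
    and D :: nat and H :: "complex poly"
  assumes "N \<ge> 1" and "K \<ge> 1"
    and "\<forall>i\<in>{1..K}. \<forall>j\<in>{1..K}. \<Gamma> i j \<in> polys_le (2 * (N - 1))"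
    and "\<exists>i\<in>{1..K}. \<exists>j\<in>{1..K}. \<Gamma> i j \<noteq> 0"
    and "factorization N K \<Gamma> X"
    and "is_gcd_le D H {(2 * (N - 1), \<Gamma> i j) | i j. i \<in> {1..K} \<and> j \<in> {1..K}}"
  shows "unique_up_to_scaling N K \<Gamma> X \<longleftrightarrow>
    eq_mod_scalar D H 0 1 \<or> ext_roots D H \<subseteq> Some ` unit_circle"
proof -
  define M where "M = N - 1"
  define S where "S = {(2 * (N - 1), \<Gamma> i j) | i j. i \<in> {1..K} \<and> j \<in> {1..K}}"
  note fac = assms(5)
  have X: "\<forall>i\<in>{1..K}. X i \<in> polys_le M"
    and \<Gamma>: "\<And>i j. i \<in> {1..K} \<Longrightarrow> j \<in> {1..K} \<Longrightarrow> \<Gamma> i j = X i * conj_rev M (X j)"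
    using fac by (auto simp: factorization_def M_def)
  obtain k l where kl: "k \<in> {1..K}" "l \<in> {1..K}" "\<Gamma> k l \<noteq> 0" using assms(4) by blast
  then have nz: "X k \<noteq> 0" using \<Gamma> by auto
  have gcd: "is_gcd_le D H S" and S_nz: "\<exists>(M, C) \<in> S. C \<noteq> 0"
    using assms(6) kl unfolding S_def by blast+
  have H: "H \<noteq> 0" "H \<in> polys_le D"
    using gcd S_nz by (auto simp: is_gcd_le_def common_divisor_le_def divides_le_def split: if_splits)
  have root_iff: "w \<in> ext_roots D H \<longleftrightarrow>
      (\<forall>i\<in>{1..K}. \<forall>j\<in>{1..K}. vanishes_at (M + M) (X i * conj_rev M (X j)) w)" for w
  proof -
    have "w \<in> ext_roots D H \<longleftrightarrow>
        (\<forall>i\<in>{1..K}. \<forall>j\<in>{1..K}. vanishes_at (2 * (N - 1)) (\<Gamma> i j) w)"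
      unfolding ext_roots_iff_vanishes_at[OF H] vanishes_at_gcd_iff[OF gcd S_nz] S_def by blast
    then show ?thesis using \<Gamma> by (simp add: M_def mult_2 del: atLeastAtMost_iff)
  qed
  have "ext_roots D H = {}" if "eq_mod_scalar D H 0 1"
  proof -
    have "vanishes_at D H w \<Longrightarrow> False" for w
      using that by (cases w) (auto simp: eq_mod_scalar_def)
    then show ?thesis using ext_roots_iff_vanishes_at[OF H] by blast
  qed
  then have rhs: "eq_mod_scalar D H 0 1 \<or> ext_roots D H \<subseteq> Some ` unit_circle \<longleftrightarrow>
      ext_roots D H \<subseteq> Some ` unit_circle"
    by auto
  show ?thesis
    unfolding rhs
  proof
    assume unique: "unique_up_to_scaling N K \<Gamma> X"
    show "ext_roots D H \<subseteq> Some ` unit_circle"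
    proof
      fix w assume "w \<in> ext_roots D H"
      then consider "\<forall>i\<in>{1..K}. vanishes_at M (X i) w"
        | "\<forall>i\<in>{1..K}. vanishes_at M (X i) (circle_reflection w)"
        using common_root_of_products[OF X] root_iff by blast
      then have "w \<in> Some ` unit_circle \<or> circle_reflection w \<in> Some ` unit_circle"
        using common_root_on_circle_if_unique[OF unique fac kl(1) nz] unfolding M_def by metis
      then show "w \<in> Some ` unit_circle"
        by (metis circle_reflection_fixed_iff circle_reflection_involution)
    qed
  next
    assume circle: "ext_roots D H \<subseteq> Some ` unit_circle"
    show "unique_up_to_scaling N K \<Gamma> X"
    proof (rule unique_if_common_roots_on_circle[OF fac kl(1) nz])
      fix w assume "\<forall>i\<in>{1..K}. vanishes_at (N - 1) (X i) w"
      then have "w \<in> ext_roots D H"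
        unfolding root_iff using X vanishes_at_mult[OF _ conj_rev_in_polys_le] by (auto simp: M_def)
      then show "w \<in> Some ` unit_circle" using circle by blast
    qed
  qed
qed

end
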